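(* Let $a\in\mathcal{P}$, let $\langle\!\langle\cdot,\cdot\rangle\!\rangle$ be a metric on the Lie algebra $T_a$, and let $(a,b)\in V^{11}_1\times V^1_{11}$ be the induced pair. Then the Ricci operator $\operatorname{ric}\in\mathfrak{gl}(T)$ of the metric is given by \[\operatorname{ric}=\tfrac14c_1(a,b)-\tfrac12c_2(a,b).\] (Here $\langle\!\langle\cdot,\cdot\rangle\!\rangle$ simply denotes the chosen scalar product.)
   Context: Let $T=\mathbb{R}^n$ with standard basis $e_1,\dots,e_n$ and dual basis $e^1,\dots,e^n$; repeated indices are summed. In the claim, $\langle\!\langle\cdot,\cdot\rangle\!\rangle$ (double angle brackets) is just a symbol for a scalar product. $V^{11}_1\subset T^*\otimes\operatorname{End}T$ is the space of linear maps $a\colon T\to\operatorname{End}(T)$, written $a=e^i\otimes a_i$ with $a_i=a(e_i)$, such that $a(v)w=-a(w)v$ and $\operatorname{tr}a(v)=0$ for all $v,w\in T$. Dually, identifying $\operatorname{End}(T^* )$ with $\operatorname{End}(T)$ via transposition, $V^1_{11}\subset T\otimes\operatorname{End}T$ is the space of linear maps $b\colon T^*\to\operatorname{End}(T)$, written $b=e_i\otimes b_i$ with $b_i=b(e^i)$, such that ${}^tb(\alpha)\beta=-{}^tb(\beta)\alpha$ and $\operatorname{tr}b(\alpha)=0$ for all $\alpha,\beta\in T^*$. $\mathcal{P}\subset V^{11}_1$ is the set of those $a$ such that $[v,w]=a(v)w$ defines a Lie bracket on $T$ (necessarily unimodular) with Killing form zero; $T_a$ denotes this Lie algebra. A metric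 on $T_a$ is a non-degenerate scalar product on $T$ of arbitrary signature, identified with the corresponding left-invariant pseudoriemannian metric on a Lie group with Lie algebra $T_a$; its Ricci operator is then an element of $\mathfrak{gl}(T)$. Let $\flat\colon T\to T^*$ be the musical isomorphism of the metric and $\sharp$ its inverse. Transporting the bracket of $T_a$ through $\flat$ gives a Lie algebra structure on $T^*$, whose adjoint map is $\alpha\mapsto\flat\circ a(\alpha^\sharp)\circ\sharp\in\operatorname{End}(T^* )$; the induced element $b\in V^1_{11}$ is $b(\alpha)={}^t(\flat\circ a(\alpha^\sharp)\circ\sharp)\in\operatorname{End}(T)$. The contractions $c_1,c_2$ are $c_1(e^i\otimes a_i,e_j\otimes b_j)=\sum_i a_i\circ b_i$ and $c_2(e^i\otimes a_i,e_j\otimes b_j)=\sum_i b_i\circ a_i$. *)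

theory Defs
  imports "HOL-Analysis.Analysis"
begin

text \<open>
  The space $T = R^n$ is \<^typ>\<open>real^'n\<close>, and $\mathrm{End}(T)$ is \<^typ>\<open>real^'n^'n\<close>. The dual space
  $T^*$ is also written \<^typ>\<open>real^'n\<close>: a vector there lists the coordinates in the dual basis
  $e^1,\ldots,e^n$, so the evaluation of \<open>\<alpha>\<close> on \<open>v\<close> is \<open>\<alpha> \<bullet> v\<close>, and the identification of
  $\mathrm{End}(T^*)$ with $\mathrm{End}(T)$ via transposition is \<^const>\<open>transpose\<close>. The inner
  product of \<^typ>\<open>real^'n\<close> occurs only as this pairing; it is unrelated to the metric.
\<close>

definition V11_1 :: "(real^'n \<Rightarrow> real^'n^'n) set" where
  "V11_1 = {a. linear a \<and> (\<forall>v w. a v *v w = - (a w *v v)) \<and> (\<forall>v. trace (a v) = 0)}"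

definition V1_11 :: "(real^'n \<Rightarrow> real^'n^'n) set" where
  "V1_11 = {b. linear b \<and> (\<forall>\<alpha> \<beta>. transpose (b \<alpha>) *v \<beta> = - (transpose (b \<beta>) *v \<alpha>))
               \<and> (\<forall>\<alpha>. trace (b \<alpha>) = 0)}"

definition contraction1 ::
  "(real^'n \<Rightarrow> real^'n^'n) \<Rightarrow> (real^'n \<Rightarrow> real^'n^'n) \<Rightarrow> real^'n^'n" where
  "contraction1 a b = (\<Sum>i\<in>UNIV. a (axis i 1) ** b (axis i 1))"

definition contraction2 ::
  "(real^'n \<Rightarrow> real^'n^'n) \<Rightarrow> (real^'n \<Rightarrow> real^'n^'n) \<Rightarrow> real^'n^'n" where
  "contraction2 a b = (\<Sum>i\<in>UNIV. b (axis i 1) ** a (axis i 1))"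


definition lie_bracket :: "(real^'n \<Rightarrow> real^'n \<Rightarrow> real^'n) \<Rightarrow> bool" where
  "lie_bracket br \<longleftrightarrow> bilinear br \<and> (\<forall>v. br v v = 0) \<and>
     (\<forall>u v w. br u (br v w) + br v (br w u) + br w (br u v) = 0)"

definition killing_form :: "(real^'n \<Rightarrow> real^'n \<Rightarrow> real^'n) \<Rightarrow> real^'n \<Rightarrow> real^'n \<Rightarrow> real" where
  "killing_form br v w = trace (matrix (br v \<circ> br w))"

definition bracket_of :: "(real^'n \<Rightarrow> real^'n^'n) \<Rightarrow> real^'n \<Rightarrow> real^'n \<Rightarrow> real^'n" where
  "bracket_of a v w = a v *v w"

definition \<P> :: "(real^'n \<Rightarrow> real^'n^'n) set" where
  "\<P> = {a \<in> V11_1. lie_bracket (bracket_of a) \<and> (\<forall>v w. killing_form (bracket_of a) v w = 0)}"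


definition is_metric :: "(real^'n \<Rightarrow> real^'n \<Rightarrow> real) \<Rightarrow> bool" where
  "is_metric g \<longleftrightarrow> bilinear g \<and> (\<forall>v w. g v w = g w v) \<and> (\<forall>v. (\<forall>w. g v w = 0) \<longrightarrow> v = 0)"

text \<open>The coordinates of the functional \<open>g v\<close> in the dual basis.\<close>

definition flat :: "(real^'n \<Rightarrow> real^'n \<Rightarrow> real) \<Rightarrow> real^'n \<Rightarrow> real^'n" where
  "flat g v = (\<chi> i. g v (axis i 1))"

definition sharp :: "(real^'n \<Rightarrow> real^'n \<Rightarrow> real) \<Rightarrow> real^'n \<Rightarrow> real^'n" where
  "sharp g = inv (flat g)"

definition induced_dual ::
  "(real^'n \<Rightarrow> real^'n \<Rightarrow> real) \<Rightarrow> (real^'n \<Rightarrow> real^'n^'n) \<Rightarrow> real^'n \<Rightarrow> real^'n^'n" where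
  "induced_dual g a \<alpha> = transpose (matrix (flat g \<circ> (*v) (a (sharp g \<alpha>)) \<circ> sharp g))"


text \<open>
  Pseudoriemannian geometry of the left-invariant metric \<open>g\<close> on a Lie group with Lie algebra
  \<open>(T, br)\<close>, restricted to left-invariant vector fields. These are identified with elements of $T$;
  inner products of left-invariant fields are constant, so their derivatives disappear from the
  compatibility of the connection with the metric. The Levi-Civita connection maps pairs of
  left-invariant fields to left-invariant fields.
\<close>

definition is_levi_civita ::
  "(real^'n \<Rightarrow> real^'n \<Rightarrow> real^'n) \<Rightarrow> (real^'n \<Rightarrow> real^'n \<Rightarrow> real) \<Rightarrow>
     (real^'n \<Rightarrow> real^'n \<Rightarrow> real^'n) \<Rightarrow> bool" where
  "is_levi_civita br g D \<longleftrightarrow> bilinear D \<and>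
     (\<forall>v w. D v w - D w v = br v w) \<and>
     (\<forall>u v w. g (D u v) w + g v (D u w) = 0)"

definition levi_civita ::
  "(real^'n \<Rightarrow> real^'n \<Rightarrow> real^'n) \<Rightarrow> (real^'n \<Rightarrow> real^'n \<Rightarrow> real) \<Rightarrow>
     real^'n \<Rightarrow> real^'n \<Rightarrow> real^'n" where
  "levi_civita br g = (THE D. is_levi_civita br g D)"

definition riemann ::
  "(real^'n \<Rightarrow> real^'n \<Rightarrow> real^'n) \<Rightarrow> (real^'n \<Rightarrow> real^'n \<Rightarrow> real) \<Rightarrow>
     real^'n \<Rightarrow> real^'n \<Rightarrow> real^'n \<Rightarrow> real^'n" where
  "riemann br g u v w = (let D = levi_civita br g in D u (D v w) - D v (D u w) - D (br u v) w)"

text \<open>The signs are such that round spheres have positive Ricci curvature.\<close>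

definition ricci_tensor ::
  "(real^'n \<Rightarrow> real^'n \<Rightarrow> real^'n) \<Rightarrow> (real^'n \<Rightarrow> real^'n \<Rightarrow> real) \<Rightarrow>
     real^'n \<Rightarrow> real^'n \<Rightarrow> real" where
  "ricci_tensor br g v w = trace (matrix (\<lambda>u. riemann br g u v w))"

definition ricci_operator ::
  "(real^'n \<Rightarrow> real^'n \<Rightarrow> real^'n) \<Rightarrow> (real^'n \<Rightarrow> real^'n \<Rightarrow> real) \<Rightarrow> real^'n^'n" where
  "ricci_operator br g = (THE R. \<forall>v w. g (R *v v) w = ricci_tensor br g v w)"


lemma flat_inner:
  assumes "bilinear g"
  shows "flat g v \<bullet> w = g v w"
proof -
  have lin: "linear (g v)" using assms by (simp add: bilinear_def)
  have "g v w = g v (\<Sum>i\<in>UNIV. w $ i *\<^sub>R axis i 1)"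
    using basis_expansion[of w] by (simp add: scalar_mult_eq_scaleR)
  also have "\<dots> = (\<Sum>i\<in>UNIV. w $ i * g v (axis i 1))"
    by (simp add: linear_sum[OF lin] linear_cmul[OF lin])
  finally show ?thesis by (simp add: flat_def inner_vec_def mult.commute)
qed

lemma linear_flat:
  assumes "bilinear g"
  shows "linear (flat g)"
  by (rule linearI) (simp_all add: flat_def vec_eq_iff bilinear_ladd[OF assms] bilinear_lmul[OF assms])

lemma bij_flat:
  assumes "is_metric g"
  shows "bij (flat g)"
proof -
  have bl: "bilinear g" using assms by (simp add: is_metric_def)
  have "inj (flat g)"
    unfolding linear_injective_0[OF linear_flat[OF bl]]
    using assms flat_inner[OF bl] by (metis inner_zero_left is_metric_def)
  then show ?thesis
    using linear_injective_imp_surjective[OF linear_flat[OF bl]] by (simp add: bij_def)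
qed

lemma flat_sharp: "is_metric g \<Longrightarrow> flat g (sharp g \<alpha>) = \<alpha>"
  by (simp add: sharp_def bij_flat bij_is_surj surj_f_inv_f)

lemma sharp_flat: "is_metric g \<Longrightarrow> sharp g (flat g v) = v"
  by (simp add: sharp_def bij_flat bij_is_inj inv_f_f)

lemma linear_sharp:
  assumes "is_metric g"
  shows "linear (sharp g)"
proof -
  have lf: "linear (flat g)" using assms linear_flat by (auto simp: is_metric_def)
  have add: "sharp g (x + y) = sharp g x + sharp g y" for x y
    by (metis assms flat_sharp sharp_flat linear_add[OF lf])
  have mul: "sharp g (c *\<^sub>R x) = c *\<^sub>R sharp g x" for c x
    by (metis assms flat_sharp sharp_flat linear_cmul[OF lf])
  show ?thesis by (rule linearI) (rule add mul)+
qed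

lemma sharp_inner: "is_metric g \<Longrightarrow> g (sharp g \<alpha>) w = \<alpha> \<bullet> w"
  by (metis flat_inner flat_sharp is_metric_def)

lemma metric_eqI:
  assumes "is_metric g" and "\<And>w. g v w = g v' w"
  shows "v = v'"
proof -
  have "g (v - v') w = 0" for w
    using assms(1) bilinear_lsub[of g v v' w] by (simp add: is_metric_def assms(2))
  then have "v - v' = 0" using assms(1) unfolding is_metric_def by blast
  then show ?thesis by simp
qed

lemma induced_dual_in_V1_11:
  assumes a: "a \<in> V11_1" and g: "is_metric g"
  shows "induced_dual g a \<in> V1_11"
proof -
  have lf: "linear (flat g)" using g linear_flat by (auto simp: is_metric_def)
  have ls: "linear (sharp g)" by (rule linear_sharp[OF g])
  have la: "linear a" using a by (simp add: V11_1_def)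
  have mat: "matrix (flat g \<circ> (*v) A \<circ> sharp g) = matrix (flat g) ** A ** matrix (sharp g)" for A
    by (simp add: matrix_compose lf ls linear_compose matrix_of_matrix_vector_mul)
  have b: "induced_dual g a \<alpha> =
      transpose (matrix (flat g) ** a (sharp g \<alpha>) ** matrix (sharp g))" for \<alpha>
    unfolding induced_dual_def mat ..
  have tb: "transpose (induced_dual g a \<alpha>) *v \<beta> = flat g (a (sharp g \<alpha>) *v sharp g \<beta>)" for \<alpha> \<beta>
    by (simp add: b transpose_transpose matrix_vector_mul_assoc[symmetric] matrix_works lf ls)
  have sf: "matrix (sharp g) ** matrix (flat g) = mat 1"
  proof -
    have "sharp g \<circ> flat g = id" using sharp_flat[OF g] by auto
    then show ?thesis using matrix_compose[OF lf ls] by (simp add: matrix_id_mat_1)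
  qed
  have "trace (induced_dual g a \<alpha>) = 0" for \<alpha>
  proof -
    have "trace (induced_dual g a \<alpha>) = trace (matrix (flat g) ** (a (sharp g \<alpha>) ** matrix (sharp g)))"
      by (simp add: b trace_def transpose_def matrix_mul_assoc)
    also have "\<dots> = trace (a (sharp g \<alpha>) ** (matrix (sharp g) ** matrix (flat g)))"
      by (subst trace_mul_sym) (simp add: matrix_mul_assoc)
    also have "\<dots> = 0" using a by (simp add: sf V11_1_def)
    finally show ?thesis .
  qed
  moreover have "flat g (a (sharp g \<alpha>) *v sharp g \<beta>) = - flat g (a (sharp g \<beta>) *v sharp g \<alpha>)" for \<alpha> \<beta>
  proof -
    have "a (sharp g \<alpha>) *v sharp g \<beta> = - (a (sharp g \<beta>) *v sharp g \<alpha>)"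
      using a unfolding V11_1_def by blast
    then show ?thesis by (simp add: linear_neg[OF lf])
  qed
  moreover have "linear (induced_dual g a)"
  proof (rule linearI)
    fix x y
    have "matrix (flat g) ** (A + B) ** matrix (sharp g)
        = matrix (flat g) ** A ** matrix (sharp g) + matrix (flat g) ** B ** matrix (sharp g)" for A B
      by (simp add: matrix_eq matrix_vector_mul_assoc[symmetric] matrix_vector_mult_add_rdistrib
          matrix_vector_right_distrib)
    then show "induced_dual g a (x + y) = induced_dual g a x + induced_dual g a y"
      by (simp add: b linear_add[OF ls] linear_add[OF la]) (simp add: transpose_def vec_eq_iff)
  next
    fix c x
    have "matrix (flat g) ** (c *\<^sub>R A) ** matrix (sharp g)
        = c *\<^sub>R (matrix (flat g) ** A ** matrix (sharp g))" for A
      by (simp add: matrix_scalar_ac scalar_matrix_assoc)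
    then show "induced_dual g a (c *\<^sub>R x) = c *\<^sub>R induced_dual g a x"
      by (simp add: b linear_cmul[OF ls] linear_cmul[OF la]) (simp add: transpose_def vec_eq_iff)
  qed
  ultimately show ?thesis unfolding V1_11_def mem_Collect_eq tb by blast
qed

text \<open>Existence and uniqueness behind the two definite descriptions above.\<close>

lemma ex1_levi_civita:
  assumes br: "lie_bracket br" and g: "is_metric g"
  shows "\<exists>!D. is_levi_civita br g D"
proof -
  have gb: "bilinear g" and gs: "\<And>v w. g v w = g w v" using g by (auto simp: is_metric_def)
  have bb: "bilinear br" using br by (simp add: lie_bracket_def)
  have skew: "br v w = - br w v" for v w
  proof -
    have "br (v + w) (v + w) = 0" "br v v = 0" "br w w = 0" using br by (auto simp: lie_bracket_def)
    then show ?thesis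
      by (simp add: bilinear_ladd[OF bb] bilinear_radd[OF bb] eq_neg_iff_add_eq_0 add.commute)
  qed
  have sk: "g (br x y) z = - g (br y x) z" for x y z
    using skew[of x y] bilinear_lneg[OF gb, of "br y x" z] by simp
  note lin = bilinear_ladd[OF gb] bilinear_radd[OF gb] bilinear_lmul[OF gb] bilinear_rmul[OF gb]
    bilinear_lneg[OF gb] bilinear_lsub[OF gb] bilinear_rneg[OF gb] bilinear_rsub[OF gb]
    bilinear_ladd[OF bb] bilinear_radd[OF bb] bilinear_lmul[OF bb] bilinear_rmul[OF bb]
  define K where "K v w z = (g (br v w) z - g (br w z) v + g (br z v) w) / 2" for v w z
  define D where "D v w = sharp g (\<chi> k. K v w (axis k 1))" for v w
  have gD: "g (D v w) z = K v w z" for v w z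
  proof -
    have lk: "linear (K v w)"
      by (rule linearI) (simp_all add: K_def lin algebra_simps add_divide_distrib diff_divide_distrib)
    have "K v w z = K v w (\<Sum>i\<in>UNIV. z $ i *\<^sub>R axis i 1)"
      using basis_expansion[of z] by (simp add: scalar_mult_eq_scaleR)
    also have "\<dots> = (\<Sum>i\<in>UNIV. z $ i * K v w (axis i 1))"
      by (simp add: linear_sum[OF lk] linear_cmul[OF lk])
    finally show ?thesis
      unfolding D_def sharp_inner[OF g] by (simp add: inner_vec_def mult.commute)
  qed
  have "bilinear D"
    unfolding bilinear_def
  proof (intro conjI allI)
    show "linear (D x)" for x
      by (rule linearI; rule metric_eqI[OF g])
        (simp_all add: lin gD K_def algebra_simps add_divide_distrib diff_divide_distrib)
    show "linear (\<lambda>x. D x y)" for y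
      by (rule linearI; rule metric_eqI[OF g])
        (simp_all add: lin gD K_def algebra_simps add_divide_distrib diff_divide_distrib)
  qed
  moreover have "D v w - D w v = br v w" for v w
  proof (rule metric_eqI[OF g])
    fix z
    show "g (D v w - D w v) z = g (br v w) z"
      unfolding lin gD K_def using sk[of w v z] sk[of w z v] sk[of v z w] by argo
  qed
  moreover have "g (D u v) w + g v (D u w) = 0" for u v w
    unfolding gs[of v "D u w"] gD K_def using sk[of w v u] sk[of w u v] sk[of v u w] by argo
  ultimately have ex: "is_levi_civita br g D" by (simp add: is_levi_civita_def)
  have "E = D" if E: "is_levi_civita br g E" for E
  proof (intro ext metric_eqI[OF g])
    fix v w z
    have t: "g (br x y) u = g (E x y) u - g (E y x) u" for x y u
      using E by (metis bilinear_lsub[OF gb] is_levi_civita_def)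
    have m: "g (E x y) u = - g (E x u) y" for x y u
      using E gs[of y "E x u"] by (smt (verit) is_levi_civita_def)
    show "g (E v w) z = g (D v w) z"
      unfolding gD K_def t using m[of v w z] m[of w v z] m[of z v w] by simp
  qed
  with ex show ?thesis by blast
qed

lemma ex1_ricci_operator:
  assumes br: "lie_bracket br" and g: "is_metric g"
  shows "\<exists>!R. \<forall>v w. g (R *v v) w = ricci_tensor br g v w"
proof -
  have bb: "bilinear br" using br by (simp add: lie_bracket_def)
  define D where "D = levi_civita br g"
  have "is_levi_civita br g D"
    unfolding D_def levi_civita_def by (rule theI'[OF ex1_levi_civita[OF br g]])
  then have Db: "bilinear D" by (simp add: is_levi_civita_def)
  note lin = bilinear_ladd[OF bb] bilinear_radd[OF bb] bilinear_lmul[OF bb] bilinear_rmul[OF bb]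
    bilinear_ladd[OF Db] bilinear_radd[OF Db] bilinear_lmul[OF Db] bilinear_rmul[OF Db]
  define t where "t i v w =
    (D (axis i 1) (D v w) - D v (D (axis i 1) w) - D (br (axis i 1) v) w) $ i" for i v w
  have ric: "ricci_tensor br g v w = (\<Sum>i\<in>UNIV. t i v w)" for v w
    by (simp add: ricci_tensor_def riemann_def D_def t_def Let_def trace_def matrix_def)
  have t: "t i (v + v') w = t i v w + t i v' w" "t i (c *\<^sub>R v) w = c * t i v w"
    "t i v (w + w') = t i v w + t i v w'" "t i v (c *\<^sub>R w) = c * t i v w" for i v v' w w' c
    unfolding t_def lin vector_minus_component vector_add_component vector_scaleR_component
    by (simp_all add: right_diff_distrib)
  have l1: "linear (\<lambda>v. ricci_tensor br g v w)" for w
    by (rule linearI) (simp_all add: ric t sum.distrib sum_distrib_left)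
  have l2: "linear (ricci_tensor br g v)" for v
    by (rule linearI) (simp_all add: ric t sum.distrib sum_distrib_left)
  have bl: "bilinear (ricci_tensor br g)" using l1 l2 by (simp add: bilinear_def)
  define F where "F = sharp g \<circ> flat (ricci_tensor br g)"
  have lF: "linear F"
    unfolding F_def by (rule linear_compose[OF linear_flat[OF bl] linear_sharp[OF g]])
  have gF: "g (matrix F *v v) w = ricci_tensor br g v w" for v w
    by (simp add: matrix_works lF) (simp add: F_def sharp_inner[OF g] flat_inner[OF bl])
  show ?thesis
  proof (rule ex1I[of _ "matrix F"])
    show "\<forall>v w. g (matrix F *v v) w = ricci_tensor br g v w" using gF by blast
    fix R assume R: "\<forall>v w. g (R *v v) w = ricci_tensor br g v w"
    have "R *v v = matrix F *v v" for v
      by (rule metric_eqI[OF g]) (simp add: R gF)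
    then show "R = matrix F" by (simp add: matrix_eq)
  qed
qed

end

theory Submission
  imports Defs
begin

text \<open>
  Let \<open>D\<close> be the Levi-Civita connection and \<open>R x\<close> the endomorphism \<open>u \<mapsto> D u x\<close>. Koszul's formula gives
  \<open>R x = -1/2 (ad x + (ad x)\<^sup>* + J x)\<close>, where \<open>J x u = (ad u)\<^sup>* x\<close> is skew-adjoint. For unimodular
  Lie algebras \<open>R x\<close> is trace-free, which reduces the Ricci tensor to \<open>- tr (R v R w)\<close>. On expanding,
  the terms \<open>tr (ad v ad w)\<close> vanish with the Killing form, the products of the self-adjoint part
  \<open>ad v + (ad v)\<^sup>*\<close> with the skew part \<open>J w\<close> are trace-free, and what remains are
  \<open>tr ((ad v)\<^sup>* ad w)\<close> and \<open>tr (J v J w)\<close>, which are the two contractions.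
\<close>

lemma matrix_add_rdistrib: "(A + B) ** C = A ** C + B ** C" for A B :: "real^'n^'m" and C :: "real^'k^'n"
  by (simp add: matrix_eq matrix_vector_mul_assoc[symmetric] matrix_vector_mult_add_rdistrib)

section \<open>Adjoints and traces with respect to the metric\<close>

lemma metric_bilinear: "is_metric g \<Longrightarrow> bilinear g"
  by (simp add: is_metric_def)

lemma metric_sym: "is_metric g \<Longrightarrow> g v w = g w v"
  by (simp add: is_metric_def)

text \<open>The vectors \<open>sharp g (axis i 1)\<close> are the \<open>g\<close>-dual of the
  standard basis, so pairing with them reads off coordinates. In this form traces match the sums in
  the contractions.\<close>

lemma trace_eq_sum_metric:
  fixes M :: "real^'n^'n"
  assumes "is_metric g"
  shows "trace M = (\<Sum>i\<in>UNIV. g (M *v axis i 1) (sharp g (axis i 1)))"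
proof -
  have "g x (sharp g (axis i 1)) = x $ i" for x i
    by (simp add: metric_sym[OF assms, of x] sharp_inner[OF assms] inner_axis')
  then show ?thesis by (simp add: trace_def matrix_vector_mult_basis column_def)
qed

text \<open>The \<open>g\<close>-adjoint, for any signature.\<close>

definition madj :: "(real^'n \<Rightarrow> real^'n \<Rightarrow> real) \<Rightarrow> real^'n^'n \<Rightarrow> real^'n^'n" where
  "madj g A = matrix (sharp g) ** transpose A ** matrix (flat g)"

lemma flat_matrix_works:
  assumes "is_metric g"
  shows "matrix (flat g) *v x = flat g x" "matrix (sharp g) *v x = sharp g x"
  using linear_flat[OF metric_bilinear[OF assms]] linear_sharp[OF assms]
  by (simp_all add: matrix_works)

lemma madj_works:
  assumes "is_metric g"
  shows "g (madj g A *v x) y = g x (A *v y)"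
proof -
  have "g (madj g A *v x) y = (transpose A *v flat g x) \<bullet> y"
    by (simp add: madj_def matrix_vector_mul_assoc[symmetric] flat_matrix_works[OF assms]
        sharp_inner[OF assms])
  also have "\<dots> = flat g x \<bullet> (A *v y)"
    by (simp add: dot_lmul_matrix)
  finally show ?thesis by (simp add: flat_inner[OF metric_bilinear[OF assms]])
qed

lemma madj_works':
  assumes "is_metric g"
  shows "g x (madj g A *v y) = g (A *v x) y"
  using madj_works[OF assms, of A y x] metric_sym[OF assms] by metis

lemma matrix_metric_eqI:
  fixes A B :: "real^'n^'n"
  assumes "is_metric g" and "\<And>x y. g (A *v x) y = g (B *v x) y"
  shows "A = B"
  using assms metric_eqI[OF assms(1)] by (metis matrix_eq)

lemma madj_mult:
  assumes "is_metric g"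
  shows "madj g (A ** B) = madj g B ** madj g A"
  by (rule matrix_metric_eqI[OF assms])
    (simp add: madj_works[OF assms] matrix_vector_mul_assoc[symmetric])

lemma madj_madj:
  assumes "is_metric g"
  shows "madj g (madj g A) = A"
  by (rule matrix_metric_eqI[OF assms]) (simp add: madj_works[OF assms] madj_works'[OF assms])

lemma trace_madj:
  assumes "is_metric g"
  shows "trace (madj g A) = trace A"
proof -
  have "(matrix (flat g) ** matrix (sharp g)) *v x = x" for x
    by (simp add: matrix_vector_mul_assoc[symmetric] flat_matrix_works[OF assms] flat_sharp[OF assms])
  then have fs: "matrix (flat g) ** matrix (sharp g) = mat 1"
    by (simp add: matrix_eq)
  have "trace (madj g A) = trace (matrix (flat g) ** (matrix (sharp g) ** transpose A))"
    unfolding madj_def by (rule trace_mul_sym)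
  also have "\<dots> = trace A"
    by (simp add: matrix_mul_assoc fs) (simp add: trace_def transpose_def)
  finally show ?thesis .
qed

lemma madj_skew:
  assumes "is_metric g" and "\<And>x y. g (J *v x) y = - g x (J *v y)"
  shows "madj g J = (-1) *\<^sub>R J"
proof (rule matrix_metric_eqI[OF assms(1)])
  fix x y
  show "g (madj g J *v x) y = g (((-1) *\<^sub>R J) *v x) y"
    unfolding scaleR_matrix_vector_assoc[symmetric]
    by (simp add: madj_works[OF assms(1)] assms(2) bilinear_lneg[OF metric_bilinear[OF assms(1)]])
qed

lemma trace_scaleR: "trace (c *\<^sub>R M) = c * trace M" for M :: "real^'n^'n"
  by (simp add: trace_def sum_distrib_left)

lemma trace_skew:
  assumes "is_metric g" and "\<And>x y. g (J *v x) y = - g x (J *v y)"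
  shows "trace J = 0"
  using trace_madj[OF assms(1), of J] by (simp only: madj_skew[OF assms(1), OF assms(2)] trace_scaleR)

text \<open>Passing to adjoints keeps the trace, reverses the product and flips the sign of
  \<open>J\<close>. Hence \<open>A + madj g A\<close> is trace-orthogonal to skew
  \<open>J\<close>.\<close>

lemma trace_madj_mult_skew:
  assumes g: "is_metric g" and J: "\<And>x y. g (J *v x) y = - g x (J *v y)"
  shows "trace (madj g A ** J) = - trace (A ** J)"
proof -
  have "trace (madj g A ** J) = trace (madj g (madj g A ** J))"
    by (simp only: trace_madj[OF g])
  also have "\<dots> = trace (((-1) *\<^sub>R J) ** A)"
    by (simp only: madj_mult[OF g] madj_madj[OF g] madj_skew[OF g, OF J])
  also have "\<dots> = - trace (J ** A)"
    by (simp only: scalar_matrix_assoc[symmetric] trace_scaleR)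
  finally show ?thesis by (simp only: trace_mul_sym[of J A])
qed

text \<open>Pairing with \<open>flat g y\<close> moves the transpose onto \<open>y\<close>, where
  \<open>sharp g\<close> cancels \<open>flat g\<close>; symmetry of \<open>g\<close> does the
  rest.\<close>

lemma induced_dual_eq_madj:
  assumes "is_metric g"
  shows "induced_dual g a \<alpha> = madj g (a (sharp g \<alpha>))"
proof -
  note lf = linear_flat[OF metric_bilinear[OF assms]] and ls = linear_sharp[OF assms]
  have sym: "transpose (matrix (flat g)) = matrix (flat g)"
    by (simp add: vec_eq_iff transpose_def matrix_def flat_def metric_sym[OF assms])
  have "transpose (induced_dual g a \<alpha>) = matrix (flat g) ** a (sharp g \<alpha>) ** matrix (sharp g)"
    by (simp add: induced_dual_def transpose_transpose matrix_compose lf ls linear_compose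
        matrix_of_matrix_vector_mul)
  then have t: "transpose (induced_dual g a \<alpha>) *v y = flat g (a (sharp g \<alpha>) *v sharp g y)" for y
    by (simp add: matrix_vector_mul_assoc[symmetric] flat_matrix_works[OF assms])
  show ?thesis
  proof (rule matrix_metric_eqI[OF assms])
    fix x y
    have "g (induced_dual g a \<alpha> *v x) y = (induced_dual g a \<alpha> *v x) \<bullet> flat g y"
      by (metis flat_inner[OF metric_bilinear[OF assms]] metric_sym[OF assms] inner_commute)
    also have "\<dots> = x \<bullet> flat g (a (sharp g \<alpha>) *v y)"
      by (metis t sharp_flat[OF assms] dot_lmul_matrix transpose_matrix_vector transpose_transpose)
    also have "\<dots> = g x (a (sharp g \<alpha>) *v y)"
      by (metis flat_inner[OF metric_bilinear[OF assms]] metric_sym[OF assms] inner_commute)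
    finally show "g (induced_dual g a \<alpha> *v x) y = g (madj g (a (sharp g \<alpha>)) *v x) y"
      by (simp add: madj_works[OF assms])
  qed
qed

text \<open>Metric compatibility, applied to three placements of the arguments, cancels every
  connection term but two equal ones.\<close>

lemma koszul:
  assumes g: "is_metric g" and D: "is_levi_civita br g D"
  shows "2 * g (D v w) z = g (br v w) z - g (br w z) v + g (br z v) w"
proof -
  have t: "g (br x y) u = g (D x y) u - g (D y x) u" for x y u
    using D by (metis bilinear_lsub[OF metric_bilinear[OF g]] is_levi_civita_def)
  have m: "g (D x y) u = - g (D x u) y" for x y u
    using D metric_sym[OF g, of y "D x u"] by (smt (verit) is_levi_civita_def)
  show ?thesis
    unfolding t using m[of v w z] m[of w v z] m[of z v w] by simp
qed

theorem proposition3p1: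
  fixes a b :: "real^'n \<Rightarrow> real^'n^'n"
    and g :: "real^'n \<Rightarrow> real^'n \<Rightarrow> real"
  assumes "a \<in> \<P>"
    and "is_metric g"
    and "b = induced_dual g a"
  shows "ricci_operator (bracket_of a) g
           = (1/4) *\<^sub>R contraction1 a b - (1/2) *\<^sub>R contraction2 a b"
proof -
  note g = assms(2)
  note gb = metric_bilinear[OF g]
  note glin = bilinear_ladd[OF gb] bilinear_radd[OF gb] bilinear_lmul[OF gb] bilinear_rmul[OF gb]
    bilinear_lneg[OF gb] bilinear_lsub[OF gb] bilinear_rneg[OF gb] bilinear_rsub[OF gb]
  have la: "linear a" and tra: "trace (a v) = 0" and br: "lie_bracket (bracket_of a)" for v
    using assms(1) by (auto simp: \<P>_def V11_1_def)
  have skew: "a v *v w = - (a w *v v)" for v w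
    using assms(1) unfolding \<P>_def V11_1_def by blast
  have killing: "trace (a v ** a w) = 0" for v w
  proof -
    have "bracket_of a v \<circ> bracket_of a w = (*v) (a v ** a w)"
      by (auto simp: bracket_of_def matrix_vector_mul_assoc)
    then show ?thesis
      using assms(1) unfolding \<P>_def killing_form_def
      by (metis (mono_tags, lifting) matrix_of_matrix_vector_mul mem_Collect_eq)
  qed

  \<comment> \<open>The Levi-Civita connection\<close>
  define D where "D = levi_civita (bracket_of a) g"
  have D: "is_levi_civita (bracket_of a) g D"
    unfolding D_def levi_civita_def by (rule theI'[OF ex1_levi_civita[OF br g]])
  then have Db: "bilinear D" and tors: "D v w - D w v = a v *v w" for v w
    by (auto simp: is_levi_civita_def bracket_of_def)
  \<comment> \<open>The variable is the direction of differentiation, over which the Ricci trace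
    runs.\<close>
  define R where "R x = matrix (\<lambda>u. D u x)" for x
  have R: "R x *v u = D u x" for x u
    using Db unfolding R_def bilinear_def by (simp add: matrix_works)

  define J where "J x = matrix (\<lambda>u. madj g (a u) *v x)" for x
  have J: "J x *v u = madj g (a u) *v x" for x u
  proof -
    have "linear (\<lambda>u. madj g (a u) *v x)"
      by (rule linearI; rule metric_eqI[OF g])
        (simp_all add: madj_works[OF g] glin linear_add[OF la] linear_cmul[OF la]
          matrix_vector_mult_add_rdistrib scaleR_matrix_vector_assoc[symmetric])
    then show ?thesis by (simp add: J_def matrix_works)
  qed
  \<comment> \<open>\<open>g (J x *v u) z\<close> equals \<open>g x (a u *v z)\<close>, which is
    alternating in \<open>u\<close> and \<open>z\<close>.\<close>
  have Jskew: "g (J x *v u) z = - g u (J x *v z)" for x u z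
  proof -
    have "g x (a u *v z) = - g x (a z *v u)"
      by (subst skew) (simp add: glin)
    then show ?thesis
      by (simp add: J metric_sym[OF g, of u "madj g A *v x" for A] madj_works[OF g])
  qed

  \<comment> \<open>After two uses of \<open>skew\<close>, the Koszul terms are, up to sign, those
    of \<open>a x\<close>, its adjoint and \<open>J x\<close>.\<close>
  have R_eq: "R x = (-1/2) *\<^sub>R (a x + madj g (a x) + J x)" for x
  proof (rule matrix_metric_eqI[OF g])
    fix u z
    have "2 * g (D u x) z = g (a u *v x) z - g (a x *v z) u + g (a z *v u) x"
      using koszul[OF g D] by (simp add: bracket_of_def)
    also have "\<dots> = - (g (a x *v u) z + g u (a x *v z) + g x (a u *v z))"
      by (subst skew[of u x], subst skew[of z u])
        (simp add: glin metric_sym[OF g, of u "a x *v z"] metric_sym[OF g, of x "a u *v z"])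
    finally show "g (R x *v u) z = g (((-1/2) *\<^sub>R (a x + madj g (a x) + J x)) *v u) z"
      unfolding scaleR_matrix_vector_assoc[symmetric]
      by (simp add: R J glin madj_works[OF g] matrix_vector_mult_add_rdistrib) argo
  qed
  have trJ: "trace (J x) = 0" for x
    by (rule trace_skew[OF g, OF Jskew])
  have trR: "trace (R x) = 0" for x
    unfolding R_eq trace_scaleR by (simp add: trace_add tra trace_madj[OF g] trJ)

  \<comment> \<open>The Ricci tensor as a trace\<close>
  have ric: "ricci_tensor (bracket_of a) g v w = - trace (R v ** R w)" for v w
  proof -
    \<comment> \<open>Vanishing torsion turns differentiation along \<open>v\<close> into
      \<open>R v + a v\<close>, so the curvature becomes an endomorphism in \<open>u\<close>. In its
      trace, \<open>R (D v w)\<close> drops out by \<open>trR\<close> and the two mixed terms cancel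
      by cyclicity.\<close>
    have Dv: "D v u = (R v + a v) *v u" for u
      using tors[of v u] by (simp add: R matrix_vector_mult_add_rdistrib algebra_simps)
    have "riemann (bracket_of a) g u v w = (R (D v w) - R v ** R w - a v ** R w + R w ** a v) *v u" for u
    proof -
      have "D (bracket_of a u v) w = - D (a v *v u) w"
        unfolding bracket_of_def by (subst skew) (simp add: bilinear_lneg[OF Db])
      then show ?thesis
        unfolding riemann_def D_def[symmetric] Let_def
        by (simp add: Dv[of "D u w"] matrix_vector_mult_add_rdistrib matrix_vector_mult_diff_rdistrib
            matrix_vector_mul_assoc[symmetric] R)
    qed
    then have "ricci_tensor (bracket_of a) g v w
        = trace (R (D v w) - R v ** R w - a v ** R w + R w ** a v)"
      by (simp add: ricci_tensor_def matrix_of_matrix_vector_mul)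
    also have "\<dots> = - trace (R v ** R w)"
      by (simp add: trace_add trace_sub trR trace_mul_sym[of "R w"])
    finally show ?thesis .
  qed

  \<comment> \<open>The 4 clears the two factors -1/2. The 2 counts both mixed products of
    \<open>a\<close> with an adjoint, which have equal trace.\<close>
  have expand: "4 * trace (R v ** R w) = 2 * trace (madj g (a w) ** a v) + trace (J v ** J w)" for v w
  proof -
    have "trace (madj g (a v) ** madj g (a w)) = 0"
      by (simp add: madj_mult[OF g, symmetric] trace_madj[OF g] killing)
    moreover have "trace (madj g (a v) ** a w) = trace (madj g (a w) ** a v)"
      using trace_madj[OF g, of "madj g (a v) ** a w"] by (simp add: madj_mult[OF g] madj_madj[OF g])
    moreover have "trace (a v ** madj g (a w)) = trace (madj g (a w) ** a v)"
      by (rule trace_mul_sym)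
    moreover have "trace (madj g (a v) ** J w) = - trace (a v ** J w)"
      "trace (J v ** madj g (a w)) = - trace (J v ** a w)"
      using trace_madj_mult_skew[OF g, OF Jskew] by (simp_all add: trace_mul_sym[of "J v"])
    moreover have "4 * trace (R v ** R w)
        = trace ((a v + madj g (a v) + J v) ** (a w + madj g (a w) + J w))"
      unfolding R_eq matrix_scalar_ac scalar_matrix_assoc[symmetric] trace_scaleR by simp
    ultimately show ?thesis
      by (simp add: matrix_add_ldistrib matrix_add_rdistrib trace_add killing)
  qed

  \<comment> \<open>The two contractions\<close>
  have b: "b \<alpha> = madj g (a (sharp g \<alpha>))" for \<alpha>
    by (simp add: assms(3) induced_dual_eq_madj[OF g])
  have gsum: "g ((\<Sum>i\<in>UNIV. M i) *v v) w = (\<Sum>i\<in>UNIV. g (M i *v v) w)"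
    for M :: "'n \<Rightarrow> real^'n^'n" and v w
  proof -
    have "linear (\<lambda>N :: real^'n^'n. g (N *v v) w)"
      by (rule linearI) (simp_all add: glin matrix_vector_mult_add_rdistrib
          scaleR_matrix_vector_assoc[symmetric])
    then show ?thesis by (rule linear_sum)
  qed
  have c1: "g (contraction1 a b *v v) w = - trace (J v ** J w)" for v w
  proof -
    \<comment> \<open>Moving \<open>a x\<close> across \<open>g\<close> gives
      \<open>J w *v x\<close>, and \<open>madj g (a y) *v v\<close> is \<open>J v *v y\<close>;
      skewness of \<open>J v\<close> gives the sign. With \<open>x\<close> and \<open>y\<close>
      running over \<open>g\<close>-dual bases this sums to a trace.\<close>
    have "g (a x *v (madj g (a y) *v v)) w = - g (J v *v (J w *v x)) y" for x y
    proof -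
      have "g (a x *v (madj g (a y) *v v)) w = g (J v *v y) (J w *v x)"
        by (simp only: J madj_works'[OF g])
      then show ?thesis
        using Jskew[of v "J w *v x" y] metric_sym[OF g, of "J w *v x" "J v *v y"] by linarith
    qed
    then show ?thesis
      by (simp add: contraction1_def gsum b trace_eq_sum_metric[OF g]
          matrix_vector_mul_assoc[symmetric] sum_negf)
  qed
  have c2: "g (contraction2 a b *v v) w = trace (madj g (a w) ** a v)" for v w
  proof -
    \<comment> \<open>The two sign changes cancel, bringing the summed vectors into argument
      position.\<close>
    have "g (a x *v v) (a y *v w) = g (a v *v x) (a w *v y)" for x y
      by (subst skew, subst skew[of y]) (simp add: glin)
    then show ?thesis
      by (simp add: contraction2_def gsum b trace_eq_sum_metric[OF g]
          matrix_vector_mul_assoc[symmetric] madj_works[OF g])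
  qed
  let ?C = "(1/4) *\<^sub>R contraction1 a b - (1/2) *\<^sub>R contraction2 a b"
  \<comment> \<open>By \<open>ric\<close> and \<open>expand\<close>, the Ricci tensor is -1/2 times
    the trace in \<open>c2\<close> minus 1/4 times that of \<open>J v ** J w\<close>; the sign in
    \<open>c1\<close> makes the latter +1/4.\<close>
  have "g (?C *v v) w = ricci_tensor (bracket_of a) g v w" for v w
    using expand[of v w]
    by (simp add: ric matrix_vector_mult_diff_rdistrib scaleR_matrix_vector_assoc[symmetric] glin c1 c2)
  then show ?thesis
    unfolding ricci_operator_def by (intro the1_equality[OF ex1_ricci_operator[OF br g]]) blast
qed

end
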